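(* Let $p$ be any prime, let $a_1,a_2,b_1,b_2$ denote the generators of $G_{(1,0)}^{(p)}$ from its presentation, and let $\mathcal{R}:=\{a_1^{k_1}a_2^{k_2}b_1^{l_1}b_2^{l_2}\mid k_1,k_2,l_1,l_2\in\{0,\ldots,p-1\}\}\subseteq G_{(1,0)}^{(p)}$. The following are equivalent for all functions $f:\{a_1,a_2,b_1,b_2\}\rightarrow\mathcal{R}$: (1) $f$ extends to a (normalized) endomorphism of $G_{(1,0)}^{(p)}$. (2) $f$ either maps each generator to itself or its image is contained in the cyclic subgroup $\langle a_1a_2^{-1}\rangle$.
   Context: For a prime $p$, the JK-group $G_{(1,0)}^{(p)}$ is the $p$-group of class $2$ generated by $a_1,a_2,b_1,b_2$ subject to the relations stating that all commutators are central together with $$a_1^p=[a_1,b_1],\quad a_2^p=[a_1,b_1],\quad b_1^p=[a_2,b_1b_2],\quad b_2^p=[a_2,b_2],\quad [a_1,a_2]=[b_1,b_2]=1.$$ It has order $p^8$, and each of its elements has a unique normal form $a_1^{k_1}a_2^{k_2}b_1^{l_1}b_2^{l_2}[a_1,b_1]^{r_1}[a_1,b_2]^{r_2}[a_2,b_1]^{r_3}[a_2,b_2]^{r_4}$ with all exponents in $\{0,\ldots,p-1\}$; its center equals its commutator subgroup and is elementary abelian with $\mathbb{F}_p$-basis $[a_1,b_1],[a_1,b_2],[a_2,b_1],[a_2,b_2]$. Thus $\mathcal{R}$, the set of elements in whose normal form the exponents of the commutators are all $0$, is a set of coset representatives of the center. An endomorphism is called normalized if it maps each of the generators $a_1,a_2,b_1,b_2$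 into $\mathcal{R}$.
   Formalization: In (2), containment in ⟨a_1a_2^{-1}⟩ is taken modulo the center, i.e. in ⟨a_1a_2^{-1}⟩Z(G). The literal claim fails for every p: a_1↦a_1a_2^{p-1}, other generators ↦1, extends to an endomorphism, but a_1a_2^{p-1}=(a_1a_2^{-1})[a_1,b_1] is not in ⟨a_1a_2^{-1}⟩. *)

theory Defs
  imports "HOL-Algebra.Generated_Groups" "HOL-Computational_Algebra.Primes"
begin

section \<open>Groups given by generators and relations\<close>

text \<open>A letter \<open>(g, True)\<close> stands for the generator \<open>g\<close> and \<open>(g, False)\<close> for its formal inverse.
  A relation is a pair \<open>(l, r)\<close> of words, read as \<open>l = r\<close>.\<close>

type_synonym 'g word = "('g \<times> bool) list"

definition winv :: "'g word \<Rightarrow> 'g word" where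
  "winv w = rev (map (\<lambda>(g, e). (g, \<not> e)) w)"

definition wpow :: "'g word \<Rightarrow> nat \<Rightarrow> 'g word" where
  "wpow w n = concat (replicate n w)"

text \<open>The commutator convention is immaterial below: in a group of class at most 2,
  \<open>u\<inverse> v\<inverse> u v\<close> and \<open>u v u\<inverse> v\<inverse>\<close> coincide.\<close>

definition wcomm :: "'g word \<Rightarrow> 'g word \<Rightarrow> 'g word" where
  "wcomm u v = winv u @ winv v @ u @ v"

text \<open>\<open>pres_eq R\<close> is the least congruence on the monoid of words that contains the relations \<open>R\<close>
  and the free cancellations, that is, equality in the group \<open>\<langle>'g | R\<rangle>\<close>.\<close>

inductive pres_eq :: "('g word \<times> 'g word) set \<Rightarrow> 'g word \<Rightarrow> 'g word \<Rightarrow> bool"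
  for R :: "('g word \<times> 'g word) set" where
  refl: "pres_eq R w w"
| sym: "pres_eq R v w \<Longrightarrow> pres_eq R w v"
| trans: "pres_eq R u v \<Longrightarrow> pres_eq R v w \<Longrightarrow> pres_eq R u w"
| cancel: "pres_eq R (u @ [(g, e), (g, \<not> e)] @ v) (u @ v)"
| rel: "(l, r) \<in> R \<Longrightarrow> pres_eq R (u @ l @ v) (u @ r @ v)"

definition word_class :: "('g word \<times> 'g word) set \<Rightarrow> 'g word \<Rightarrow> 'g word set" where
  "word_class R w = {v. pres_eq R w v}"

definition presented_group :: "('g word \<times> 'g word) set \<Rightarrow> 'g word set monoid" where
  "presented_group R =
     \<lparr>carrier = range (word_class R),
      monoid.mult = (\<lambda>X Y. {w. \<exists>x\<in>X. \<exists>y\<in>Y. pres_eq R (x @ y) w}),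
      one = word_class R []\<rparr>"

lemma pres_eq_append_left: "pres_eq R v w \<Longrightarrow> pres_eq R (u @ v) (u @ w)"
proof (induction rule: pres_eq.induct)
  case (cancel s g e t)
  show ?case using pres_eq.cancel[of R "u @ s" g e t] by simp
next
  case (rel l r s t)
  then show ?case using pres_eq.rel[of l r R "u @ s" t] by simp
qed (blast intro: pres_eq.intros)+

lemma pres_eq_append_right: "pres_eq R v w \<Longrightarrow> pres_eq R (v @ u) (w @ u)"
proof (induction rule: pres_eq.induct)
  case (cancel s g e t)
  show ?case using pres_eq.cancel[of R s g e "t @ u"] by simp
next
  case (rel l r s t)
  then show ?case using pres_eq.rel[of l r R s "t @ u"] by simp
qed (blast intro: pres_eq.intros)+

lemma pres_eq_append:
  "pres_eq R u u' \<Longrightarrow> pres_eq R v v' \<Longrightarrow> pres_eq R (u @ v) (u' @ v')"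
  by (blast intro: pres_eq.trans pres_eq_append_left pres_eq_append_right)

lemma word_class_eq_iff: "word_class R u = word_class R v \<longleftrightarrow> pres_eq R u v"
  unfolding word_class_def by (blast intro: pres_eq.intros)

lemma pres_eq_winv: "pres_eq R (winv w @ w) []"
proof (induction w)
  case Nil
  show ?case by (simp add: winv_def pres_eq.refl)
next
  case (Cons x w)
  obtain g e where x: "x = (g, e)" by (cases x)
  have "pres_eq R (winv w @ [(g, \<not> e), (g, \<not> \<not> e)] @ w) (winv w @ w)"
    by (rule pres_eq.cancel)
  then have "pres_eq R (winv (x # w) @ x # w) (winv w @ w)"
    by (simp add: winv_def x)
  then show ?case using Cons.IH by (rule pres_eq.trans)
qed

lemma carrier_presented_group: "carrier (presented_group R) = range (word_class R)"
  by (simp add: presented_group_def)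

lemma one_presented_group: "\<one>\<^bsub>presented_group R\<^esub> = word_class R []"
  by (simp add: presented_group_def)

lemma mult_presented_group:
  "word_class R u \<otimes>\<^bsub>presented_group R\<^esub> word_class R v = word_class R (u @ v)"
  unfolding presented_group_def word_class_def
  by (auto intro: pres_eq.intros pres_eq_append)

lemma group_presented_group: "group (presented_group R)"
proof (rule groupI)
  fix x assume "x \<in> carrier (presented_group R)"
  then obtain w where "x = word_class R w" by (auto simp: carrier_presented_group)
  then show "\<exists>y\<in>carrier (presented_group R). y \<otimes>\<^bsub>presented_group R\<^esub> x = \<one>\<^bsub>presented_group R\<^esub>"
    by (intro bexI[of _ "word_class R (winv w)"])
       (auto simp: carrier_presented_group mult_presented_group one_presented_group
          word_class_eq_iff pres_eq_winv)
qed (auto simp: carrier_presented_group mult_presented_group one_presented_group)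


section \<open>The JK-group\<close>

datatype jk_gen = A1 | A2 | B1 | B2

abbreviation letter :: "'g \<Rightarrow> 'g word" where
  "letter g \<equiv> [(g, True)]"

definition jk_relations :: "nat \<Rightarrow> (jk_gen word \<times> jk_gen word) set" where
  "jk_relations p =
     {(wcomm (wcomm u v) w, []) | u v w. True} \<union>
     {(wpow (letter A1) p, wcomm (letter A1) (letter B1)),
      (wpow (letter A2) p, wcomm (letter A1) (letter B1)),
      (wpow (letter B1) p, wcomm (letter A2) (letter B1 @ letter B2)),
      (wpow (letter B2) p, wcomm (letter A2) (letter B2)),
      (wcomm (letter A1) (letter A2), []),
      (wcomm (letter B1) (letter B2), [])}"

definition jk_group :: "nat \<Rightarrow> jk_gen word set monoid" where
  "jk_group p = presented_group (jk_relations p)"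

definition jk_elem :: "nat \<Rightarrow> jk_gen \<Rightarrow> jk_gen word set" where
  "jk_elem p g = word_class (jk_relations p) (letter g)"

definition jk_gens :: "nat \<Rightarrow> jk_gen word set set" where
  "jk_gens p = {jk_elem p A1, jk_elem p A2, jk_elem p B1, jk_elem p B2}"

definition jk_reps :: "nat \<Rightarrow> jk_gen word set set" where
  "jk_reps p =
     {jk_elem p A1 [^]\<^bsub>jk_group p\<^esub> k1 \<otimes>\<^bsub>jk_group p\<^esub> jk_elem p A2 [^]\<^bsub>jk_group p\<^esub> k2
        \<otimes>\<^bsub>jk_group p\<^esub> jk_elem p B1 [^]\<^bsub>jk_group p\<^esub> l1 \<otimes>\<^bsub>jk_group p\<^esub> jk_elem p B2 [^]\<^bsub>jk_group p\<^esub> l2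
      | (k1 :: nat) (k2 :: nat) (l1 :: nat) (l2 :: nat).
        k1 < p \<and> k2 < p \<and> l1 < p \<and> l2 < p}"

definition normalized_endomorphism :: "nat \<Rightarrow> (jk_gen word set \<Rightarrow> jk_gen word set) \<Rightarrow> bool" where
  "normalized_endomorphism p \<phi> \<longleftrightarrow>
     \<phi> \<in> hom (jk_group p) (jk_group p) \<and> \<phi> ` jk_gens p \<subseteq> jk_reps p"

text \<open>For elements of \<^const>\<open>jk_reps\<close>, being contained in the cyclic subgroup generated by
  \<open>a\<^sub>1 a\<^sub>2\<inverse>\<close> has to be read modulo the center, i.e. as membership in \<open>\<langle>a\<^sub>1 a\<^sub>2\<inverse>\<rangle> Z(G)\<close>:
  since \<open>a\<^sub>2\<^sup>p = [a\<^sub>1,b\<^sub>1] \<noteq> 1\<close>, the representative of the class of \<open>(a\<^sub>1 a\<^sub>2\<inverse>)\<^sup>k\<close> with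
  \<open>0 < k < p\<close> is \<open>a\<^sub>1\<^sup>k a\<^sub>2\<^sup>p\<^sup>-\<^sup>k = (a\<^sub>1 a\<^sub>2\<inverse>)\<^sup>k [a\<^sub>1,b\<^sub>1]\<close>, and the subgroup of \<open>G\<close> generated by
  \<open>a\<^sub>1 a\<^sub>2\<inverse>\<close> itself meets \<^const>\<open>jk_reps\<close> only in \<open>1\<close>.\<close>

definition center :: "('a, 'b) monoid_scheme \<Rightarrow> 'a set" where
  "center G = {z \<in> carrier G. \<forall>x\<in>carrier G. z \<otimes>\<^bsub>G\<^esub> x = x \<otimes>\<^bsub>G\<^esub> z}"

end

theory Submission
  imports Defs
begin

text \<open>Since the group has class 2, a map \<open>f\<close> on the generators extends to an endomorphism iff the images
  satisfy the six remaining relations. Comparing exponents of the commutators, these become quadratic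
  equations modulo \<open>p\<close> in the 16 exponents of the images; elementary case distinctions show that they are
  solved only by the identity and by maps into the span of \<open>a\<^sub>1 a\<^sub>2\<inverse>\<close> modulo the center. For \<open>p = 2\<close> the
  equations carry the extra terms \<open>(p choose 2) x\<^sub>i y\<^sub>j\<close>, and one has a propositional problem. That the
  exponents are invariants modulo \<open>p\<close> is seen by evaluating words in an explicit group of exponent
  vectors. Conversely, elements \<open>a\<^sub>1\<^sup>k a\<^sub>2\<^sup>l\<close> with \<open>p\<close> dividing \<open>k + l\<close> commute and have trivial \<open>p\<close>-th powers.\<close>

section \<open>Words, substitutions and homomorphisms\<close>

lemma winv_Nil [simp]: "winv [] = []"
  by (simp add: winv_def)

lemma winv_Cons [simp]: "winv ((g, e) # w) = winv w @ [(g, \<not> e)]"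
  by (simp add: winv_def)

lemma winv_append [simp]: "winv (u @ v) = winv v @ winv u"
  by (simp add: winv_def)

lemma winv_winv [simp]: "winv (winv w) = w"
  by (induction w) auto

lemma pres_eq_winv_append_iff: "pres_eq R (winv u @ v) [] \<longleftrightarrow> pres_eq R u v"
proof
  assume "pres_eq R (winv u @ v) []"
  then have "pres_eq R (u @ winv u @ v) u"
    using pres_eq_append_left by fastforce
  moreover have "pres_eq R (u @ winv u @ v) v"
    using pres_eq_append_right[OF pres_eq_winv[of R "winv u"], of v] by simp
  ultimately show "pres_eq R u v" by (blast intro: pres_eq.intros)
next
  assume "pres_eq R u v"
  then have "pres_eq R (winv u @ v) (winv u @ u)"
    by (blast intro: pres_eq_append_left pres_eq.sym)
  then show "pres_eq R (winv u @ v) []" using pres_eq_winv pres_eq.trans by blast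
qed

text \<open>\<open>wcomm u v\<close> is literally \<open>winv (v @ u) @ (u @ v)\<close>, so trivial
  commutators can be handled as equations without inverses.\<close>

lemma wcomm_eq_Nil_iff: "pres_eq R (wcomm u v) [] \<longleftrightarrow> pres_eq R (v @ u) (u @ v)"
  using pres_eq_winv_append_iff[of R "v @ u" "u @ v"] by (simp add: wcomm_def)

lemma word_class_in_carrier [simp]: "word_class R w \<in> carrier (presented_group R)"
  by (simp add: carrier_presented_group)

lemma word_class_wpow:
  "word_class R (wpow w n) = word_class R w [^]\<^bsub>presented_group R\<^esub> n"
proof (induction n)
  case 0
  show ?case by (simp add: wpow_def one_presented_group)
next
  case (Suc n)
  have "word_class R (wpow w (Suc n)) =
      word_class R w \<otimes>\<^bsub>presented_group R\<^esub> word_class R w [^]\<^bsub>presented_group R\<^esub> n"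
    by (simp add: Suc.IH[symmetric] mult_presented_group) (simp add: wpow_def)
  then show ?case
    by (simp only: monoid.nat_pow_Suc2[OF group.is_monoid[OF group_presented_group] word_class_in_carrier])
qed

lemma word_class_winv: "word_class R (winv w) = inv\<^bsub>presented_group R\<^esub> word_class R w"
  by (rule group.inv_equality[OF group_presented_group, symmetric])
    (simp_all add: mult_presented_group one_presented_group
      word_class_eq_iff pres_eq_winv)

lemma word_class_wcomm:
  "word_class R (wcomm u v) = inv\<^bsub>presented_group R\<^esub> word_class R u \<otimes>\<^bsub>presented_group R\<^esub>
     inv\<^bsub>presented_group R\<^esub> word_class R v \<otimes>\<^bsub>presented_group R\<^esub> word_class R u
     \<otimes>\<^bsub>presented_group R\<^esub> word_class R v"
  by (simp add: wcomm_def mult_presented_group word_class_winv[symmetric])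

lemma word_class_in_center_iff:
  "word_class R w \<in> center (presented_group R) \<longleftrightarrow> (\<forall>u. pres_eq R (w @ u) (u @ w))"
  by (auto simp: center_def carrier_presented_group mult_presented_group word_class_eq_iff)

lemma commute_append:
  assumes "pres_eq R (u @ v) (v @ u)" and "pres_eq R (u @ w) (w @ u)"
  shows "pres_eq R (u @ (v @ w)) ((v @ w) @ u)"
proof -
  have "pres_eq R ((u @ v) @ w) ((v @ u) @ w)" by (rule pres_eq_append_right[OF assms(1)])
  moreover have "pres_eq R (v @ (u @ w)) (v @ (w @ u))" by (rule pres_eq_append_left[OF assms(2)])
  ultimately show ?thesis by (simp add: pres_eq.trans)
qed

lemma commute_wpow: "pres_eq R (u @ v) (v @ u) \<Longrightarrow> pres_eq R (u @ wpow v n) (wpow v n @ u)"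
proof (induction n)
  case 0
  show ?case by (simp add: wpow_def pres_eq.refl)
next
  case (Suc n)
  have "wpow v (Suc n) = v @ wpow v n" by (simp add: wpow_def)
  with Suc show ?case using commute_append by metis
qed

section \<open>Substitution of words for generators\<close>

definition word_subst :: "('g \<Rightarrow> 'h word) \<Rightarrow> 'g word \<Rightarrow> 'h word" where
  "word_subst \<sigma> w = concat (map (\<lambda>(g, e). if e then \<sigma> g else winv (\<sigma> g)) w)"

lemma word_subst_append [simp]: "word_subst \<sigma> (u @ v) = word_subst \<sigma> u @ word_subst \<sigma> v"
  by (simp add: word_subst_def)

lemma word_subst_Nil [simp]: "word_subst \<sigma> [] = []"
  by (simp add: word_subst_def)

lemma word_subst_Cons [simp]:
  "word_subst \<sigma> ((g, e) # w) = (if e then \<sigma> g else winv (\<sigma> g)) @ word_subst \<sigma> w"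
  by (simp add: word_subst_def)

lemma word_subst_winv [simp]: "word_subst \<sigma> (winv w) = winv (word_subst \<sigma> w)"
  by (induction w) auto

lemma word_subst_wcomm [simp]:
  "word_subst \<sigma> (wcomm u v) = wcomm (word_subst \<sigma> u) (word_subst \<sigma> v)"
  by (simp add: wcomm_def)

lemma word_subst_wpow [simp]: "word_subst \<sigma> (wpow w n) = wpow (word_subst \<sigma> w) n"
  by (induction n) (simp_all add: wpow_def)

lemma pres_eq_subst:
  assumes "\<And>l r. (l, r) \<in> R \<Longrightarrow> pres_eq R' (word_subst \<sigma> l) (word_subst \<sigma> r)"
    and "pres_eq R u v"
  shows "pres_eq R' (word_subst \<sigma> u) (word_subst \<sigma> v)"
  using assms(2)
proof (induction rule: pres_eq.induct)
  case (cancel u g e v)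
  have "pres_eq R' (word_subst \<sigma> [(g, e)] @ word_subst \<sigma> [(g, \<not> e)]) []"
    using pres_eq_winv[of R' "winv (\<sigma> g)"] pres_eq_winv[of R' "\<sigma> g"] by simp
  from pres_eq_append_left[OF pres_eq_append_right[OF this]] show ?case
    by simp
next
  case (rel l r u v)
  then show ?case by (simp add: assms(1) pres_eq_append_left pres_eq_append_right)
qed (blast intro: pres_eq.intros)+

text \<open>Von Dyck's theorem, the source of the endomorphisms in the direction from (2) to
  (1).\<close>

lemma subst_hom:
  assumes "\<And>l r. (l, r) \<in> R \<Longrightarrow> pres_eq R' (word_subst \<sigma> l) (word_subst \<sigma> r)"
  shows "\<exists>\<phi> \<in> hom (presented_group R) (presented_group R').
    \<forall>w. \<phi> (word_class R w) = word_class R' (word_subst \<sigma> w)"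
proof -
  \<comment> \<open>The chosen representative does not matter, since substitution respects
    \<open>pres_eq\<close>.\<close>
  define \<phi> where "\<phi> X = word_class R' (word_subst \<sigma> (SOME w. w \<in> X))" for X
  have \<phi>: "\<phi> (word_class R w) = word_class R' (word_subst \<sigma> w)" for w
  proof -
    have "w \<in> word_class R w" by (simp add: word_class_def pres_eq.refl)
    then have "pres_eq R w (SOME v. v \<in> word_class R w)"
      unfolding word_class_def mem_Collect_eq by (rule someI)
    then show ?thesis
      unfolding \<phi>_def word_class_eq_iff using pres_eq_subst[of R R' \<sigma>, OF assms] pres_eq.sym by blast
  qed
  moreover have "\<phi> \<in> hom (presented_group R) (presented_group R')"
    by (rule homI) (auto simp: carrier_presented_group mult_presented_group \<phi>)
  ultimately show ?thesis by blast
qed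

text \<open>Uniqueness counterpart of von Dyck's theorem: an arbitrary homomorphism may be replaced
  by a substitution on words.\<close>

lemma hom_word_class:
  assumes "\<phi> \<in> hom (presented_group R) (presented_group R')"
    and "\<And>g. \<phi> (word_class R (letter g)) = word_class R' (\<sigma> g)"
  shows "\<phi> (word_class R w) = word_class R' (word_subst \<sigma> w)"
proof -
  interpret group_hom "presented_group R" "presented_group R'" \<phi>
    using assms(1) by (simp add: group_hom_def group_hom_axioms_def group_presented_group)
  show ?thesis
  proof (induction w)
    case Nil
    show ?case using hom_one by (simp add: one_presented_group)
  next
    case (Cons x w)
    obtain g e where x: "x = (g, e)" by (cases x)
    have "winv (letter g) = [(g, False)]" by (simp add: winv_def)
    then have x': "\<phi> (word_class R [x]) = word_class R' (word_subst \<sigma> [x])"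
      using assms(2)[of g] hom_inv[of "word_class R (letter g)"]
      by (cases e) (auto simp: x word_class_winv[symmetric])
    have "\<phi> (word_class R ([x] @ w)) = word_class R' (word_subst \<sigma> ([x] @ w))"
      unfolding mult_presented_group[symmetric] word_subst_append x'[symmetric] Cons.IH[symmetric]
      by (rule hom_mult) simp_all
    then show ?case by simp
  qed
qed

section \<open>Exponent vectors\<close>

text \<open>\<open>Coord x\<^sub>1 x\<^sub>2 y\<^sub>1 y\<^sub>2 r\<^sub>1\<^sub>1 r\<^sub>1\<^sub>2 r\<^sub>2\<^sub>1 r\<^sub>2\<^sub>2\<close> stands for
  \<open>a\<^sub>1\<^sup>x\<^sup>1 a\<^sub>2\<^sup>x\<^sup>2 b\<^sub>1\<^sup>y\<^sup>1 b\<^sub>2\<^sup>y\<^sup>2 \<Prod> [a\<^sub>i, b\<^sub>j]\<^sup>r\<^sup>i\<^sup>j\<close> in the class-2 group without the power relations. Its group operation is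
  written additively although it is not commutative; the correction \<open>- x\<^sub>i' * y\<^sub>j\<close> comes from
  \<open>b\<^sub>j a\<^sub>i = a\<^sub>i b\<^sub>j [a\<^sub>i, b\<^sub>j]\<inverse>\<close>.\<close>

datatype coord = Coord (cx1: int) (cx2: int) (cy1: int) (cy2: int)
  (c11: int) (c12: int) (c21: int) (c22: int)

instantiation coord :: group_add
begin

definition "0 = Coord 0 0 0 0 0 0 0 0"

fun plus_coord where
  "Coord x1 x2 y1 y2 r11 r12 r21 r22 + Coord x1' x2' y1' y2' r11' r12' r21' r22' =
    Coord (x1 + x1') (x2 + x2') (y1 + y1') (y2 + y2')
      (r11 + r11' - x1' * y1) (r12 + r12' - x1' * y2) (r21 + r21' - x2' * y1) (r22 + r22' - x2' * y2)"

fun uminus_coord where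
  "- Coord x1 x2 y1 y2 r11 r12 r21 r22 =
    Coord (- x1) (- x2) (- y1) (- y2)
      (- r11 - x1 * y1) (- r12 - x1 * y2) (- r21 - x2 * y1) (- r22 - x2 * y2)"

definition "(s :: coord) - t = s + - t"

instance
proof
  fix s t u :: coord
  show "s + t + u = s + (t + u)"
    by (cases s; cases t; cases u) (simp add: algebra_simps)
  show "0 + s = s" "s + 0 = s" "- s + s = 0"
    by (cases s; simp add: zero_coord_def algebra_simps)+
  show "s + - t = s - t" by (simp add: minus_coord_def)
qed

end

definition coord_comm :: "coord \<Rightarrow> coord \<Rightarrow> coord" where
  "coord_comm s t = - s + - t + s + t"

lemma coord_comm_Coord:
  "coord_comm (Coord x1 x2 y1 y2 r11 r12 r21 r22) (Coord x1' x2' y1' y2' r11' r12' r21' r22') =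
    Coord 0 0 0 0 (x1 * y1' - x1' * y1) (x1 * y2' - x1' * y2) (x2 * y1' - x2' * y1) (x2 * y2' - x2' * y2)"
  by (simp add: coord_comm_def algebra_simps)

text \<open>Adding the copies one by one moves each \<open>a\<close>-part past 0, 1, ...,
  \<open>n - 1\<close> copies of the \<open>b\<close>-part, which sums to
  \<open>n choose 2\<close>.\<close>

lemma sum_list_replicate_Coord:
  "sum_list (replicate n (Coord x1 x2 y1 y2 0 0 0 0)) =
     Coord (int n * x1) (int n * x2) (int n * y1) (int n * y2)
       (- int (n choose 2) * x1 * y1) (- int (n choose 2) * x1 * y2)
       (- int (n choose 2) * x2 * y1) (- int (n choose 2) * x2 * y2)"
  by (induction n) (auto simp: zero_coord_def algebra_simps numeral_2_eq_2)

text \<open>Congruence modulo the normal subgroup of the power relations: by \<open>a\<^sub>1\<^sup>p = a\<^sub>2\<^sup>p = [a\<^sub>1, b\<^sub>1]\<close>,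
  \<open>b\<^sub>1\<^sup>p = [a\<^sub>2, b\<^sub>1] [a\<^sub>2, b\<^sub>2]\<close> and \<open>b\<^sub>2\<^sup>p = [a\<^sub>2, b\<^sub>2]\<close>, the multiples of \<open>p\<close> that are removed from the
  generator exponents are carried over to the commutator exponents.\<close>

definition coord_cong :: "int \<Rightarrow> coord \<Rightarrow> coord \<Rightarrow> bool" where
  "coord_cong p s t \<longleftrightarrow> (\<exists>k1 k2 l1 l2.
     cx1 s = cx1 t + p * k1 \<and> cx2 s = cx2 t + p * k2 \<and>
     cy1 s = cy1 t + p * l1 \<and> cy2 s = cy2 t + p * l2 \<and>
     p dvd c11 s - c11 t + k1 + k2 \<and> p dvd c12 s - c12 t \<and>
     p dvd c21 s - c21 t + l1 \<and> p dvd c22 s - c22 t + l1 + l2)"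

lemma coord_congI:
  "p dvd r11 - r11' + k1 + k2 \<Longrightarrow> p dvd r12 - r12' \<Longrightarrow> p dvd r21 - r21' + l1 \<Longrightarrow>
   p dvd r22 - r22' + l1 + l2 \<Longrightarrow> x1 = x1' + p * k1 \<Longrightarrow> x2 = x2' + p * k2 \<Longrightarrow>
   y1 = y1' + p * l1 \<Longrightarrow> y2 = y2' + p * l2 \<Longrightarrow>
   coord_cong p (Coord x1 x2 y1 y2 r11 r12 r21 r22) (Coord x1' x2' y1' y2' r11' r12' r21' r22')"
  unfolding coord_cong_def by auto

lemma coord_congE:
  assumes "coord_cong p s t"
  obtains x1 x2 y1 y2 r11 r12 r21 r22 k1 k2 l1 l2 r11' r12' r21' r22' where
    "t = Coord x1 x2 y1 y2 r11 r12 r21 r22"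
    "s = Coord (x1 + p * k1) (x2 + p * k2) (y1 + p * l1) (y2 + p * l2) r11' r12' r21' r22'"
    "p dvd r11' - r11 + k1 + k2" "p dvd r12' - r12" "p dvd r21' - r21 + l1"
    "p dvd r22' - r22 + l1 + l2"
proof -
  from assms obtain k1 k2 l1 l2 where
    "cx1 s = cx1 t + p * k1" "cx2 s = cx2 t + p * k2" "cy1 s = cy1 t + p * l1" "cy2 s = cy2 t + p * l2"
    "p dvd c11 s - c11 t + k1 + k2" "p dvd c12 s - c12 t" "p dvd c21 s - c21 t + l1"
    "p dvd c22 s - c22 t + l1 + l2" unfolding coord_cong_def by blast
  then show thesis
    by (intro that[of "cx1 t" "cx2 t" "cy1 t" "cy2 t" "c11 t" "c12 t" "c21 t" "c22 t" k1 k2 l1 l2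
          "c11 s" "c12 s" "c21 s" "c22 s"]) (cases s; cases t; simp)+
qed

lemma coord_cong_refl: "coord_cong p s s"
  by (cases s) (auto intro!: coord_congI[where ?k1.0 = 0 and ?k2.0 = 0 and ?l1.0 = 0 and ?l2.0 = 0])

lemma coord_cong_sym:
  assumes "coord_cong p s t"
  shows "coord_cong p t s"
  using assms
proof (cases rule: coord_congE)
  case (1 x1 x2 y1 y2 r11 r12 r21 r22 k1 k2 l1 l2 r11' r12' r21' r22')
  show ?thesis unfolding 1(1,2)
    by (rule coord_congI[where ?k1.0 = "- k1" and ?k2.0 = "- k2" and ?l1.0 = "- l1" and ?l2.0 = "- l2"])
       (use 1(3-) in \<open>algebra | simp\<close>)+
qed

lemma coord_cong_trans:
  assumes "coord_cong p s t" "coord_cong p t u"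
  shows "coord_cong p s u"
proof -
  from assms(1) obtain k1 k2 l1 l2 where st:
    "cx1 s = cx1 t + p * k1" "cx2 s = cx2 t + p * k2" "cy1 s = cy1 t + p * l1" "cy2 s = cy2 t + p * l2"
    "p dvd c11 s - c11 t + k1 + k2" "p dvd c12 s - c12 t" "p dvd c21 s - c21 t + l1"
    "p dvd c22 s - c22 t + l1 + l2" unfolding coord_cong_def by blast
  from assms(2) obtain k1' k2' l1' l2' where tu:
    "cx1 t = cx1 u + p * k1'" "cx2 t = cx2 u + p * k2'" "cy1 t = cy1 u + p * l1'" "cy2 t = cy2 u + p * l2'"
    "p dvd c11 t - c11 u + k1' + k2'" "p dvd c12 t - c12 u" "p dvd c21 t - c21 u + l1'"
    "p dvd c22 t - c22 u + l1' + l2'" unfolding coord_cong_def by blast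
  show ?thesis unfolding coord_cong_def
    by (rule exI[of _ "k1 + k1'"], rule exI[of _ "k2 + k2'"], rule exI[of _ "l1 + l1'"],
        rule exI[of _ "l2 + l2'"], intro conjI; (use st tu in algebra))
qed

text \<open>The carries simply add up: shifting generator exponents by multiples of \<open>p\<close>
  alters the bilinear corrections only by multiples of \<open>p\<close>.\<close>

lemma coord_cong_add:
  assumes "coord_cong p s s'" "coord_cong p t t'"
  shows "coord_cong p (s + t) (s' + t')"
  using assms(1)
proof (cases rule: coord_congE)
  case s: (1 x1 x2 y1 y2 r11 r12 r21 r22 k1 k2 l1 l2 q11 q12 q21 q22)
  show ?thesis using assms(2)
  proof (cases rule: coord_congE)
    case t: (1 x1' x2' y1' y2' r11' r12' r21' r22' k1' k2' l1' l2' q11' q12' q21' q22')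
    show ?thesis unfolding s(1,2) t(1,2) plus_coord.simps
      by (rule coord_congI[where ?k1.0 = "k1 + k1'" and ?k2.0 = "k2 + k2'" and ?l1.0 = "l1 + l1'"
            and ?l2.0 = "l2 + l2'"])
       (use s(3-) t(3-) in \<open>algebra | simp add: algebra_simps\<close>)+
  qed
qed

section \<open>Evaluation of words as exponent vectors\<close>

definition coord_eval :: "('g \<Rightarrow> coord) \<Rightarrow> 'g word \<Rightarrow> coord" where
  "coord_eval h w = sum_list (map (\<lambda>(g, e). if e then h g else - h g) w)"

lemma coord_eval_append [simp]: "coord_eval h (u @ v) = coord_eval h u + coord_eval h v"
  by (simp add: coord_eval_def)

lemma coord_eval_Nil [simp]: "coord_eval h [] = 0"
  by (simp add: coord_eval_def)

lemma coord_eval_Cons [simp]: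
  "coord_eval h ((g, e) # w) = (if e then h g else - h g) + coord_eval h w"
  by (simp add: coord_eval_def)

lemma coord_eval_winv [simp]: "coord_eval h (winv w) = - coord_eval h w"
  by (induction w) (auto simp: minus_add simp del: add_uminus_conv_diff)

lemma coord_eval_wcomm [simp]:
  "coord_eval h (wcomm u v) = coord_comm (coord_eval h u) (coord_eval h v)"
  by (simp add: wcomm_def coord_comm_def add.assoc del: add_uminus_conv_diff)

lemma coord_eval_wpow [simp]: "coord_eval h (wpow w n) = sum_list (replicate n (coord_eval h w))"
  by (induction n) (simp_all add: wpow_def)

lemma coord_cong_eval:
  assumes "\<And>l r. (l, r) \<in> R \<Longrightarrow> coord_cong p (coord_eval h l) (coord_eval h r)"
    and "pres_eq R u v"
  shows "coord_cong p (coord_eval h u) (coord_eval h v)"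
  using assms(2)
proof (induction rule: pres_eq.induct)
  case (cancel u g e v)
  have "coord_eval h (u @ [(g, e), (g, \<not> e)] @ v) = coord_eval h (u @ v)"
    by (simp add: add.assoc[symmetric])
  then show ?case by (simp only: coord_cong_refl)
next
  case (rel l r u v)
  then show ?case by (auto intro!: coord_cong_add coord_cong_refl assms(1))
qed (blast intro: coord_cong_refl coord_cong_sym coord_cong_trans)+

text \<open>Reduces a relation between the images of the generators to the original relation
  evaluated at the exponent vectors of these images.\<close>

lemma coord_eval_subst:
  "coord_eval h (word_subst \<sigma> w) = coord_eval (\<lambda>g. coord_eval h (\<sigma> g)) w"
  by (induction w) auto

section \<open>Invariants of the JK-group\<close>

fun jk_coord :: "jk_gen \<Rightarrow> coord" where
  "jk_coord A1 = Coord 1 0 0 0 0 0 0 0"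
| "jk_coord A2 = Coord 0 1 0 0 0 0 0 0"
| "jk_coord B1 = Coord 0 0 1 0 0 0 0 0"
| "jk_coord B2 = Coord 0 0 0 1 0 0 0 0"

lemma coord_comm_comm: "coord_comm (coord_comm s t) u = 0"
  by (cases s; cases t; cases u) (simp add: coord_comm_Coord zero_coord_def)

text \<open>The class-2 relators evaluate exactly to 0, and each power relation needs a single carry
  1, at the generator whose \<open>p\<close>-th power is taken.\<close>

lemma coord_cong_jk_relations:
  assumes "(l, r) \<in> jk_relations p"
  shows "coord_cong (int p) (coord_eval jk_coord l) (coord_eval jk_coord r)"
proof -
  have "coord_cong (int p) (Coord (int p) 0 0 0 0 0 0 0) (Coord 0 0 0 0 1 0 0 0)"
    by (rule coord_congI[where ?k1.0 = 1 and ?k2.0 = 0 and ?l1.0 = 0 and ?l2.0 = 0]) simp_all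
  moreover have "coord_cong (int p) (Coord 0 (int p) 0 0 0 0 0 0) (Coord 0 0 0 0 1 0 0 0)"
    by (rule coord_congI[where ?k1.0 = 0 and ?k2.0 = 1 and ?l1.0 = 0 and ?l2.0 = 0]) simp_all
  moreover have "coord_cong (int p) (Coord 0 0 (int p) 0 0 0 0 0) (Coord 0 0 0 0 0 0 1 1)"
    by (rule coord_congI[where ?k1.0 = 0 and ?k2.0 = 0 and ?l1.0 = 1 and ?l2.0 = 0]) simp_all
  moreover have "coord_cong (int p) (Coord 0 0 0 (int p) 0 0 0 0) (Coord 0 0 0 0 0 0 0 1)"
    by (rule coord_congI[where ?k1.0 = 0 and ?k2.0 = 0 and ?l1.0 = 0 and ?l2.0 = 1]) simp_all
  moreover have "coord_cong (int p) (Coord 0 0 0 0 0 0 0 0) 0"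
    by (simp add: coord_cong_refl flip: zero_coord_def)
  ultimately show ?thesis
    using assms unfolding jk_relations_def
    by (auto simp: coord_comm_comm coord_cong_refl sum_list_replicate_Coord coord_comm_Coord)
qed

lemma jk_pres_eq_coord_cong:
  "pres_eq (jk_relations p) u v \<Longrightarrow> coord_cong (int p) (coord_eval jk_coord u) (coord_eval jk_coord v)"
  by (rule coord_cong_eval[OF coord_cong_jk_relations])

section \<open>Exponents of normal forms, central elements and powers of
  \<open>a1 a2^-1\<close>\<close>

definition rep_word :: "nat \<Rightarrow> nat \<Rightarrow> nat \<Rightarrow> nat \<Rightarrow> jk_gen word" where
  "rep_word k1 k2 l1 l2 =
     wpow (letter A1) k1 @ wpow (letter A2) k2 @ wpow (letter B1) l1 @ wpow (letter B2) l2"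

lemma coord_eval_rep_word:
  "coord_eval jk_coord (rep_word k1 k2 l1 l2) = Coord (int k1) (int k2) (int l1) (int l2) 0 0 0 0"
  by (simp add: rep_word_def sum_list_replicate_Coord)

lemma jk_reps_eq:
  "jk_reps p = {word_class (jk_relations p) (rep_word k1 k2 l1 l2) | k1 k2 l1 l2.
     k1 < p \<and> k2 < p \<and> l1 < p \<and> l2 < p}"
  by (simp add: jk_reps_def jk_elem_def jk_group_def rep_word_def word_class_wpow[symmetric]
      mult_presented_group)

lemma jk_gens_eq: "jk_gens p = range (jk_elem p)"
proof -
  have "(UNIV :: jk_gen set) = {A1, A2, B1, B2}" using jk_gen.exhaust by auto
  then show ?thesis unfolding \<open>UNIV = _\<close> jk_gens_def by (simp only: image_insert image_empty)
qed

lemma center_coords: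
  assumes "word_class (jk_relations p) w \<in> center (presented_group (jk_relations p))"
    and "coord_eval jk_coord w = Coord x1 x2 y1 y2 r11 r12 r21 r22" and "p > 0"
  shows "int p dvd x1" "int p dvd x2" "int p dvd y1" "int p dvd y2"
proof -
  have *: "coord_cong (int p) (coord_eval jk_coord w + jk_coord g) (jk_coord g + coord_eval jk_coord w)" for g
  proof -
    have "pres_eq (jk_relations p) (w @ letter g) (letter g @ w)"
      using assms(1) unfolding word_class_in_center_iff by blast
    from jk_pres_eq_coord_cong[OF this] show ?thesis by simp
  qed
  \<comment> \<open>Moving \<open>B1\<close> past \<open>w\<close> costs \<open>x1\<close> and
    \<open>x2\<close> in the commutator exponents; the generator exponents agree, so
    \<open>p > 0\<close> leaves no carries. \<open>A1\<close> likewise detects \<open>y1\<close> and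
    \<open>y2\<close>.\<close>
  show "int p dvd x1" "int p dvd x2"
    using *[of B1] assms(2,3) by (auto simp: coord_cong_def)
  show "int p dvd y1" "int p dvd y2"
    using *[of A1] assms(2,3) by (auto simp: coord_cong_def)
qed

text \<open>For a suitable representative \<open>w\<close> the exponent sum vanishes over the
  integers, not just modulo \<open>p\<close>; these conditions are closed under products and
  inverses.\<close>

lemma generate_coords:
  assumes "X \<in> generate (presented_group R) {word_class R (letter A1 @ winv (letter A2))}"
  obtains w where "X = word_class R w"
    "cx1 (coord_eval jk_coord w) + cx2 (coord_eval jk_coord w) = 0"
    "cy1 (coord_eval jk_coord w) = 0" "cy2 (coord_eval jk_coord w) = 0"
proof -
  let ?P = "\<lambda>t. cx1 t + cx2 t = 0 \<and> cy1 t = 0 \<and> cy2 t = 0"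
  have add: "?P (s + t)" if "?P s" "?P t" for s t using that by (cases s; cases t) auto
  have neg: "?P (- s)" if "?P s" for s using that by (cases s) auto
  have gen: "?P (coord_eval jk_coord (letter A1 @ winv (letter A2)))" by (simp add: minus_coord_def)
  from assms have "\<exists>w. X = word_class R w \<and> ?P (coord_eval jk_coord w)"
  proof (induction rule: generate.induct)
    case one
    show ?case by (rule exI[of _ "[]"]) (simp add: one_presented_group zero_coord_def)
  next
    case (incl h)
    then show ?case using gen by blast
  next
    case (inv h)
    then show ?case
      by (intro exI[of _ "winv (letter A1 @ winv (letter A2))"])
        (use neg[OF gen] in \<open>simp del: coord_eval_append add: word_class_winv[symmetric]\<close>)
  next
    case (eng h1 h2)
    then obtain u v where "h1 = word_class R u" "?P (coord_eval jk_coord u)"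
      "h2 = word_class R v" "?P (coord_eval jk_coord v)" by blast
    then show ?case
      by (intro exI[of _ "u @ v"]) (use add in \<open>simp add: mult_presented_group\<close>)
  qed
  then show thesis using that by blast
qed

definition cyclic_mod_center :: "nat \<Rightarrow> jk_gen word set set" where
  "cyclic_mod_center p =
     generate (jk_group p) {jk_elem p A1 \<otimes>\<^bsub>jk_group p\<^esub> inv\<^bsub>jk_group p\<^esub> jk_elem p A2}
       <#>\<^bsub>jk_group p\<^esub> center (jk_group p)"

lemma jk_quotient: "jk_elem p A1 \<otimes>\<^bsub>jk_group p\<^esub> inv\<^bsub>jk_group p\<^esub> jk_elem p A2 =
    word_class (jk_relations p) (letter A1 @ winv (letter A2))"
  by (simp only: jk_elem_def jk_group_def word_class_winv[symmetric] mult_presented_group)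

text \<open>The cyclic factor has exponent sum 0 and no \<open>b\<close>-part, the central factor
  has exponents divisible by \<open>p\<close>, and \<open>coord_cong\<close> moves generator
  exponents only by multiples of \<open>p\<close>.\<close>

lemma cyclic_mod_center_coords:
  assumes "word_class (jk_relations p) (rep_word k1 k2 l1 l2) \<in> cyclic_mod_center p" and "p > 0"
  shows "int p dvd int k1 + int k2" "int p dvd int l1" "int p dvd int l2"
proof -
  let ?R = "jk_relations p"
  from assms(1) obtain X Z where X: "X \<in> generate (presented_group ?R) {word_class ?R (letter A1 @ winv (letter A2))}"
    and Z: "Z \<in> center (presented_group ?R)"
    and eq: "word_class ?R (rep_word k1 k2 l1 l2) = X \<otimes>\<^bsub>presented_group ?R\<^esub> Z"
    unfolding cyclic_mod_center_def jk_quotient set_mult_def unfolding jk_group_def by blast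
  from X obtain u where u: "X = word_class ?R u"
    "cx1 (coord_eval jk_coord u) + cx2 (coord_eval jk_coord u) = 0"
    "cy1 (coord_eval jk_coord u) = 0" "cy2 (coord_eval jk_coord u) = 0" by (rule generate_coords)
  from Z obtain v where v: "Z = word_class ?R v" by (auto simp: center_def carrier_presented_group)
  obtain x1 x2 y1 y2 r11 r12 r21 r22 where cv: "coord_eval jk_coord v = Coord x1 x2 y1 y2 r11 r12 r21 r22"
    by (cases "coord_eval jk_coord v")
  note dv = center_coords[OF Z[unfolded v] cv assms(2)]
  obtain x1' x2' y1' y2' r11' r12' r21' r22' where cu: "coord_eval jk_coord u = Coord x1' x2' y1' y2' r11' r12' r21' r22'"
    by (cases "coord_eval jk_coord u")
  have "coord_cong (int p) (coord_eval jk_coord (rep_word k1 k2 l1 l2)) (coord_eval jk_coord (u @ v))"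
    using eq jk_pres_eq_coord_cong unfolding u(1) v mult_presented_group word_class_eq_iff by blast
  then have "coord_cong (int p) (Coord (int k1) (int k2) (int l1) (int l2) 0 0 0 0)
     (Coord x1' x2' y1' y2' r11' r12' r21' r22' + Coord x1 x2 y1 y2 r11 r12 r21 r22)"
    by (simp add: coord_eval_rep_word cu cv)
  then obtain m1 m2 n1 n2 where "int k1 = x1' + x1 + int p * m1" "int k2 = x2' + x2 + int p * m2"
     "int l1 = y1' + y1 + int p * n1" "int l2 = y2' + y2 + int p * n2"
    unfolding coord_cong_def by auto
  moreover have "x1' + x2' = 0" "y1' = 0" "y2' = 0" using u cu by auto
  ultimately show "int p dvd int k1 + int k2" "int p dvd int l1" "int p dvd int l2"
    using dv by (algebra, simp_all)
qed

section \<open>Powers and commutators in the JK-group\<close>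

lemma wcomm_central: "pres_eq (jk_relations p) (u @ wcomm v w) (wcomm v w @ u)"
proof -
  have "(wcomm (wcomm v w) u, []) \<in> jk_relations p" unfolding jk_relations_def by blast
  from pres_eq.rel[OF this, of "[]" "[]"] show ?thesis by (simp add: wcomm_eq_Nil_iff)
qed

lemma A1_A2_relations:
  "pres_eq (jk_relations p) (wpow (letter A1) p) (wcomm (letter A1) (letter B1))"
  "pres_eq (jk_relations p) (wpow (letter A2) p) (wcomm (letter A1) (letter B1))"
  "pres_eq (jk_relations p) (letter A2 @ letter A1) (letter A1 @ letter A2)"
proof -
  show "pres_eq (jk_relations p) (wpow (letter A1) p) (wcomm (letter A1) (letter B1))"
    using pres_eq.rel[of _ _ "jk_relations p" "[]" "[]"] by (simp add: jk_relations_def)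
  show "pres_eq (jk_relations p) (wpow (letter A2) p) (wcomm (letter A1) (letter B1))"
    using pres_eq.rel[of _ _ "jk_relations p" "[]" "[]"] by (simp add: jk_relations_def)
  have "pres_eq (jk_relations p) (wcomm (letter A1) (letter A2)) []"
    using pres_eq.rel[of _ _ "jk_relations p" "[]" "[]"] by (simp add: jk_relations_def)
  then show "pres_eq (jk_relations p) (letter A2 @ letter A1) (letter A1 @ letter A2)"
    unfolding wcomm_eq_Nil_iff .
qed

lemma (in group) conj_nat_pow:
  assumes "x \<in> carrier G" "g \<in> carrier G"
  shows "(inv g \<otimes> x \<otimes> g) [^] (n :: nat) = inv g \<otimes> x [^] n \<otimes> g"
proof (induction n)
  case (Suc n)
  have "(inv g \<otimes> x \<otimes> g) [^] Suc n = (inv g \<otimes> x [^] n \<otimes> g) \<otimes> (inv g \<otimes> x \<otimes> g)"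
    by (simp only: nat_pow_Suc Suc.IH)
  also have "\<dots> = inv g \<otimes> x [^] n \<otimes> (g \<otimes> inv g) \<otimes> x \<otimes> g"
    using assms by (simp only: m_assoc inv_closed m_closed nat_pow_closed)
  finally have "(inv g \<otimes> x \<otimes> g) [^] Suc n = \<dots>" .
  then show ?case using assms by (simp add: m_assoc)
qed (use assms in simp)

text \<open>\<open>a c\<close> is the conjugate of \<open>a\<close> by \<open>b\<close>, so its
  \<open>n\<close>-th power is the conjugate of \<open>a^n\<close>, which is \<open>a^n\<close>
  again; as \<open>a\<close> and \<open>c\<close> commute, it is also
  \<open>a^n c^n\<close>.\<close>

lemma (in group) commutator_pow_eq_one:
  assumes "a \<in> carrier G" "b \<in> carrier G"
    and c: "c = inv a \<otimes> inv b \<otimes> a \<otimes> b" "c \<otimes> a = a \<otimes> c"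
    and "b \<otimes> a [^] (n :: nat) = a [^] n \<otimes> b"
  shows "c [^] n = \<one>"
proof -
  have cc: "c \<in> carrier G" using assms by simp
  have "a \<otimes> c = a \<otimes> inv a \<otimes> inv b \<otimes> a \<otimes> b" using assms(1,2) by (simp only: c(1) m_assoc inv_closed m_closed)
  also have "\<dots> = inv b \<otimes> a \<otimes> b" using assms(1,2) by simp
  finally have "(a \<otimes> c) [^] n = inv b \<otimes> a [^] n \<otimes> b"
    using conj_nat_pow assms(1,2) by simp
  also have "\<dots> = inv b \<otimes> (b \<otimes> a [^] n)" using assms by (simp add: m_assoc)
  also have "\<dots> = a [^] n" using assms(1,2) by (simp flip: m_assoc)
  finally have "a [^] n \<otimes> c [^] n = a [^] n \<otimes> \<one>"
    using pow_mult_distrib[OF c(2)[symmetric] assms(1) cc] assms(1) by simp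
  then show ?thesis using assms(1) cc by simp
qed

text \<open>The relation \<open>a1^p = [a1,b1]\<close> makes \<open>a1^p\<close> central, so it
  commutes with \<open>b1\<close> and \<open>commutator_pow_eq_one\<close> applies.\<close>

lemma wcomm_A1_B1_pow: "pres_eq (jk_relations p) (wpow (wcomm (letter A1) (letter B1)) p) []"
proof -
  let ?R = "jk_relations p"
  interpret group "presented_group ?R" by (rule group_presented_group)
  let ?c = "wcomm (letter A1) (letter B1)"
  have "pres_eq ?R (letter B1 @ wpow (letter A1) p) (letter B1 @ ?c)"
    by (intro pres_eq_append_left A1_A2_relations)
  moreover have "pres_eq ?R (letter B1 @ ?c) (?c @ letter B1)"
    by (rule wcomm_central)
  moreover have "pres_eq ?R (?c @ letter B1) (wpow (letter A1) p @ letter B1)"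
    by (intro pres_eq_append_right pres_eq.sym[OF A1_A2_relations(1)])
  ultimately have "pres_eq ?R (letter B1 @ wpow (letter A1) p) (wpow (letter A1) p @ letter B1)"
    by (blast intro: pres_eq.trans)
  then have *: "word_class ?R (letter B1) \<otimes>\<^bsub>presented_group ?R\<^esub> word_class ?R (letter A1) [^]\<^bsub>presented_group ?R\<^esub> p
     = word_class ?R (letter A1) [^]\<^bsub>presented_group ?R\<^esub> p \<otimes>\<^bsub>presented_group ?R\<^esub> word_class ?R (letter B1)"
    by (simp only: word_class_eq_iff[symmetric] mult_presented_group[symmetric] word_class_wpow)
  have "word_class ?R ?c \<otimes>\<^bsub>presented_group ?R\<^esub> word_class ?R (letter A1) =
      word_class ?R (letter A1) \<otimes>\<^bsub>presented_group ?R\<^esub> word_class ?R ?c"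
    unfolding mult_presented_group word_class_eq_iff by (rule pres_eq.sym[OF wcomm_central])
  from commutator_pow_eq_one[OF _ _ word_class_wcomm this *]
  show ?thesis by (simp add: word_class_wpow[symmetric] one_presented_group word_class_eq_iff)
qed

text \<open>\<open>a1\<close> and \<open>a2\<close> commute and share the \<open>p\<close>-th power
  \<open>c = [a1,b1]\<close>, so the power is \<open>c^(k+l)\<close>, and \<open>c^p\<close> is
  trivial.\<close>

lemma A1_A2_word_pow:
  assumes "p dvd k + l"
  shows "pres_eq (jk_relations p) (wpow (wpow (letter A1) k @ wpow (letter A2) l) p) []"
proof -
  let ?R = "jk_relations p"
  let ?G = "presented_group ?R"
  interpret group ?G by (rule group_presented_group)
  define a b c where abc: "a = word_class ?R (letter A1)" "b = word_class ?R (letter A2)"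
    "c = word_class ?R (wcomm (letter A1) (letter B1))"
  have carr: "a \<in> carrier ?G" "b \<in> carrier ?G" "c \<in> carrier ?G" by (simp_all add: abc)
  have ap: "a [^]\<^bsub>?G\<^esub> p = c" "b [^]\<^bsub>?G\<^esub> p = c"
    using A1_A2_relations(1,2) by (simp_all only: abc word_class_wpow[symmetric] word_class_eq_iff)
  have ab: "a \<otimes>\<^bsub>?G\<^esub> b = b \<otimes>\<^bsub>?G\<^esub> a"
    using pres_eq.sym[OF A1_A2_relations(3)] by (simp only: abc mult_presented_group word_class_eq_iff)
  have cp: "c [^]\<^bsub>?G\<^esub> p = \<one>\<^bsub>?G\<^esub>"
    using wcomm_A1_B1_pow by (simp only: abc one_presented_group word_class_wpow[symmetric] word_class_eq_iff)
  have comm: "a [^]\<^bsub>?G\<^esub> k \<otimes>\<^bsub>?G\<^esub> b [^]\<^bsub>?G\<^esub> l = b [^]\<^bsub>?G\<^esub> l \<otimes>\<^bsub>?G\<^esub> a [^]\<^bsub>?G\<^esub> k"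
    using group_commutes_pow[OF group_commutes_pow[OF ab, of k, symmetric], of l] carr by simp
  obtain m where m: "k + l = p * m" using assms by blast
  have "(a [^]\<^bsub>?G\<^esub> k \<otimes>\<^bsub>?G\<^esub> b [^]\<^bsub>?G\<^esub> l) [^]\<^bsub>?G\<^esub> p
      = a [^]\<^bsub>?G\<^esub> (p * k) \<otimes>\<^bsub>?G\<^esub> b [^]\<^bsub>?G\<^esub> (p * l)"
    using pow_mult_distrib[OF comm] carr by (simp add: nat_pow_pow mult.commute)
  also have "\<dots> = c [^]\<^bsub>?G\<^esub> (p * m)"
    using carr by (simp add: nat_pow_pow[symmetric] ap nat_pow_mult m del: nat_pow_pow)
  also have "\<dots> = \<one>\<^bsub>?G\<^esub>"
    using carr by (simp add: nat_pow_pow[symmetric] cp del: nat_pow_pow)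
  finally show ?thesis
    by (simp only: abc word_class_wpow[symmetric] one_presented_group mult_presented_group word_class_eq_iff)
qed

text \<open>Write \<open>a1^k a2^l\<close> as \<open>(a1 a2^-1)^k a2^(k+l)\<close>; the last factor
  is a power of \<open>a2^p = [a1,b1]\<close>, hence central.\<close>

lemma A1_A2_word_in_cyclic_mod_center:
  assumes "p dvd k + l"
  shows "word_class (jk_relations p) (wpow (letter A1) k @ wpow (letter A2) l) \<in> cyclic_mod_center p"
proof -
  let ?R = "jk_relations p"
  let ?G = "presented_group ?R"
  interpret group ?G by (rule group_presented_group)
  define a b where abc: "a = word_class ?R (letter A1)" "b = word_class ?R (letter A2)"
  have carr: "a \<in> carrier ?G" "b \<in> carrier ?G" by (simp_all add: abc)
  have ab: "a \<otimes>\<^bsub>?G\<^esub> b = b \<otimes>\<^bsub>?G\<^esub> a"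
    using pres_eq.sym[OF A1_A2_relations(3)] by (simp only: abc mult_presented_group word_class_eq_iff)
  have comm: "a \<otimes>\<^bsub>?G\<^esub> inv\<^bsub>?G\<^esub> b = inv\<^bsub>?G\<^esub> b \<otimes>\<^bsub>?G\<^esub> a"
    using ab carr by (metis inv_closed inv_solve_left inv_solve_right m_assoc m_closed)
  let ?z = "wpow (letter A2) (k + l)"
  obtain m where m: "k + l = p * m" using assms by blast
  have pw: "wpow (letter A2) (p * m) = wpow (wpow (letter A2) p) m"
    by (induction m) (simp_all add: wpow_def replicate_add)
  have "pres_eq ?R (u @ wpow (letter A2) p) (wpow (letter A2) p @ u)" for u
    by (rule pres_eq.trans[OF pres_eq_append_left[OF A1_A2_relations(2)]])
       (rule pres_eq.trans[OF wcomm_central pres_eq_append_right[OF pres_eq.sym[OF A1_A2_relations(2)]]])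
  then have "word_class ?R ?z \<in> center ?G"
    unfolding word_class_in_center_iff m pw by (blast intro: pres_eq.sym commute_wpow)
  moreover have "(a \<otimes>\<^bsub>?G\<^esub> inv\<^bsub>?G\<^esub> b) [^]\<^bsub>?G\<^esub> int k \<in> generate ?G {a \<otimes>\<^bsub>?G\<^esub> inv\<^bsub>?G\<^esub> b}"
    using generate_pow carr by blast
  moreover have "word_class ?R (wpow (letter A1) k @ wpow (letter A2) l) =
      (a \<otimes>\<^bsub>?G\<^esub> inv\<^bsub>?G\<^esub> b) [^]\<^bsub>?G\<^esub> int k \<otimes>\<^bsub>?G\<^esub> word_class ?R ?z"
  proof -
    have "(a \<otimes>\<^bsub>?G\<^esub> inv\<^bsub>?G\<^esub> b) [^]\<^bsub>?G\<^esub> k \<otimes>\<^bsub>?G\<^esub> b [^]\<^bsub>?G\<^esub> (k + l) =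
       a [^]\<^bsub>?G\<^esub> k \<otimes>\<^bsub>?G\<^esub> inv\<^bsub>?G\<^esub> (b [^]\<^bsub>?G\<^esub> k) \<otimes>\<^bsub>?G\<^esub> (b [^]\<^bsub>?G\<^esub> k \<otimes>\<^bsub>?G\<^esub> b [^]\<^bsub>?G\<^esub> l)"
      using pow_mult_distrib[OF comm] carr by (simp add: nat_pow_mult nat_pow_inv)
    also have "\<dots> = a [^]\<^bsub>?G\<^esub> k \<otimes>\<^bsub>?G\<^esub> (inv\<^bsub>?G\<^esub> (b [^]\<^bsub>?G\<^esub> k) \<otimes>\<^bsub>?G\<^esub> b [^]\<^bsub>?G\<^esub> k) \<otimes>\<^bsub>?G\<^esub> b [^]\<^bsub>?G\<^esub> l"
      using carr by (simp only: m_assoc nat_pow_closed inv_closed m_closed)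
    also have "\<dots> = a [^]\<^bsub>?G\<^esub> k \<otimes>\<^bsub>?G\<^esub> b [^]\<^bsub>?G\<^esub> l" using carr by simp
    finally show ?thesis
      by (simp only: int_pow_int mult_presented_group[symmetric] word_class_wpow abc)
  qed
  ultimately show ?thesis
    unfolding cyclic_mod_center_def set_mult_def jk_group_def jk_elem_def abc by blast
qed

section \<open>The defining relations modulo p\<close>

text \<open>In the next lemma \<open>(a,b,c,d)\<close>, \<open>(a',b',c',d')\<close>, \<open>(e,f,g,h)\<close>, \<open>(e',f',g',h')\<close> are the exponents of
  \<open>a\<^sub>1,a\<^sub>2,b\<^sub>1,b\<^sub>2\<close> in the images of \<open>a\<^sub>1\<close>, \<open>a\<^sub>2\<close>, \<open>b\<^sub>1\<close>, \<open>b\<^sub>2\<close>. The equal \<open>p\<close>-th powers of \<open>a\<^sub>1\<close> and \<open>a\<^sub>2\<close> force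
  \<open>(c,d) = (c',d')\<close>, and if this vector is nonzero, commutativity of the images of \<open>a\<^sub>1\<close> and \<open>a\<^sub>2\<close> makes them
  equal; then the images of \<open>b\<^sub>1\<close> and \<open>b\<^sub>2\<close> are the \<open>(k+1)\<close>-fold and \<open>k\<close>-fold multiple of their difference,
  which is impossible.\<close>

lemma odd_prime_solutions:
  fixes p a b c d a' b' c' d' e f g h e' f' g' h' :: int
  assumes p: "prime p"
    and A1: "p dvd a + b - (a*g - e*c)" "p dvd a*h - e*d" "p dvd c - (b*g - f*c)" "p dvd c + d - (b*h - f*d)"
    and A2: "p dvd a' + b' - (a*g - e*c)" "p dvd a*h - e*d" "p dvd c' - (b*g - f*c)" "p dvd c' + d' - (b*h - f*d)"
    and B1: "p dvd e + f - (a'*(g+g') - (e+e')*c')" "p dvd a'*(h+h') - (e+e')*d'"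
      "p dvd g - (b'*(g+g') - (f+f')*c')" "p dvd g + h - (b'*(h+h') - (f+f')*d')"
    and B2: "p dvd e' + f' - (a'*g' - e'*c')" "p dvd a'*h' - e'*d'"
      "p dvd g' - (b'*g' - f'*c')" "p dvd g' + h' - (b'*h' - f'*d')"
    and A12: "p dvd a*c' - a'*c" "p dvd a*d' - a'*d" "p dvd b*c' - b'*c" "p dvd b*d' - b'*d"
    and B12: "p dvd e*g' - e'*g" "p dvd e*h' - e'*h" "p dvd f*g' - f'*g" "p dvd f*h' - f'*h"
  shows "(p dvd a-1 \<and> p dvd b \<and> p dvd c \<and> p dvd d \<and> p dvd a' \<and> p dvd b'-1 \<and> p dvd c' \<and> p dvd d' \<and>
      p dvd e \<and> p dvd f \<and> p dvd g-1 \<and> p dvd h \<and> p dvd e' \<and> p dvd f' \<and> p dvd g' \<and> p dvd h'-1) \<or>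
    (p dvd a+b \<and> p dvd c \<and> p dvd d \<and> p dvd a'+b' \<and> p dvd c' \<and> p dvd d' \<and>
      p dvd e+f \<and> p dvd g \<and> p dvd h \<and> p dvd e'+f' \<and> p dvd g' \<and> p dvd h')"
proof (cases "p dvd c \<and> p dvd d")
  note pd = prime_dvd_multD[OF p]
  case True
  have c': "p dvd c'" "p dvd d'" using A1 A2 True by algebra+
  show ?thesis
  proof (cases "p dvd b' - 1 \<and> p dvd a'")
    \<comment> \<open>Unless \<open>a2\<close> is fixed modulo \<open>p\<close>, all
      \<open>b\<close>-parts vanish; then every commutator is trivial, and the first equation of
      each power relation makes the exponent sums vanish.\<close>
    case False
    have b2: "p dvd (b' - 1) * g'" "p dvd a' * h'" "p dvd (b' - 1) * h' - g'"
      using B2 c' by algebra+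
    have b1: "p dvd (b' - 1) * g + b' * g'" "p dvd a' * (h + h')" "p dvd (b' - 1) * h + b' * h' - g"
      using B1 c' by algebra+
    have g: "p dvd g' \<and> p dvd h' \<and> p dvd g \<and> p dvd h"
    proof (cases "p dvd b' - 1")
      case b': False
      have g': "p dvd g'" using pd[OF b2(1)] b' by blast
      then have "p dvd (b' - 1) * h'" using b2 by algebra
      then have h': "p dvd h'" using pd b' by blast
      have "p dvd (b' - 1) * g" using b1 g' by algebra
      then have g: "p dvd g" using pd b' by blast
      have "p dvd (b' - 1) * h" using b1 h' g by algebra
      then have "p dvd h" using pd b' by blast
      with g g' h' show ?thesis by blast
    next
      case b': True
      then have a': "\<not> p dvd a'" using False by blast
      have g': "p dvd g'" using b2 b' by algebra
      have h': "p dvd h'" using pd[OF b2(2)] a' by blast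
      have "p dvd h + h'" using pd[OF b1(2)] a' by blast
      then have h: "p dvd h" using h' by algebra
      have "p dvd g" using b1 b' h h' by algebra
      with h g' h' show ?thesis by blast
    qed
    have "p dvd a + b" "p dvd a' + b'" "p dvd e + f" "p dvd e' + f'"
      using A1(1) A2(1) B1(1) B2(1) g True c' by algebra+
    with g True c' show ?thesis by blast
  next
    \<comment> \<open>Now \<open>a2\<close> is fixed, and the other images are pinned down;
      \<open>a * g\<close> being congruent to 1 allows \<open>a\<close> and \<open>g\<close> to be
      cancelled.\<close>
    case a': True
    have g': "p dvd g'" using B2 a' c' by algebra
    have h': "p dvd h' - g" using B1 a' c' by algebra
    have ag: "p dvd a * g - 1" using A1 A2 a' c' True by algebra
    have na: "\<not> p dvd a" and ng: "\<not> p dvd g"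
    proof -
      have "\<not> p dvd 1" using p not_prime_unit by blast
      moreover have "p dvd 1" if "p dvd a" using that ag by algebra
      moreover have "p dvd 1" if "p dvd g" using that ag by algebra
      ultimately show "\<not> p dvd a" "\<not> p dvd g" by blast+
    qed
    have "p dvd a * h" "p dvd b * g" using A1 True by algebra+
    then have h: "p dvd h" and b: "p dvd b" using pd na ng by blast+
    have a: "p dvd a - 1" using A1 A2 a' True b by algebra
    have g: "p dvd g - 1" using a ag by algebra
    have "p dvd e" "p dvd f" "p dvd e'" "p dvd f'" using B12 g h g' h' by algebra+
    moreover have "p dvd h' - 1" using h' g by algebra
    ultimately show ?thesis using a b True a' c' g h g' by blast
  qed
next
  note pd = prime_dvd_multD[OF p]
  case False
  have cc: "p dvd c - c'" "p dvd d - d'" using A1 A2 by algebra+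
  have ca: "p dvd c * (a - a')" "p dvd d * (a - a')" "p dvd c * (b - b')" "p dvd d * (b - b')"
    using A12 cc by algebra+
  have aa: "p dvd a - a'" "p dvd b - b'"
    using pd[OF ca(1)] pd[OF ca(2)] pd[OF ca(3)] pd[OF ca(4)] False by blast+
  \<comment> \<open>As the images of \<open>a1\<close> and \<open>a2\<close> agree modulo
    \<open>p\<close>, dividing the relation for \<open>b1\<close> by that for \<open>b2\<close>
    shows that the difference of these two images satisfies the same power relation as the image of
    \<open>a1\<close>. Hence both have the same \<open>b\<close>-part.\<close>
  have D: "p dvd g - g' - c" "p dvd h - h' - d" "p dvd e - e' + (f - f') - (a + b)"
    using A1 B1 B2 aa cc by algebra+
  have DB: "p dvd (e - e') * g' - e' * c" "p dvd (e - e') * h' - e' * d"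
       "p dvd (f - f') * g' - f' * c" "p dvd (f - f') * h' - f' * d"
    using B12 D by algebra+
  have inv: "\<exists>k. p dvd y - k * x" if "\<not> p dvd x" for x y
  proof -
    have "coprime p x" using p that prime_imp_coprime by blast
    then obtain u v where "u * p + v * x = 1" by (metis bezout_int coprime_imp_gcd_eq_1)
    then have "p dvd y - (y * v) * x" by algebra
    then show ?thesis by blast
  qed
  \<comment> \<open>Since the images of \<open>b1\<close> and \<open>b2\<close> commute, the
    \<open>a\<close>-part of the latter is a multiple of the \<open>a\<close>-part of their
    difference; \<open>k\<close> is read off from a nonzero entry of \<open>(c,d)\<close>.\<close>
  have "\<exists>k. p dvd e' - k * (e - e') \<and> p dvd f' - k * (f - f')"
  proof (cases "p dvd c")
    case c: False
    then obtain k where k: "p dvd g' - k * c" using inv by blast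
    have "p dvd c * (e' - k * (e - e'))" "p dvd c * (f' - k * (f - f'))" using DB k by algebra+
    then show ?thesis using pd c by blast
  next
    case True
    then have d: "\<not> p dvd d" using False by blast
    then obtain k where k: "p dvd h' - k * d" using inv by blast
    have "p dvd d * (e' - k * (e - e'))" "p dvd d * (f' - k * (f - f'))" using DB k by algebra+
    then show ?thesis using pd d by blast
  qed
  then obtain k where k: "p dvd e' - k * (e - e')" "p dvd f' - k * (f - f')" by blast
  have k1: "p dvd (e - e') * (g' - k * c)" "p dvd (e - e') * (h' - k * d)"
    "p dvd (f - f') * (g' - k * c)" "p dvd (f - f') * (h' - k * d)"
    using DB k by algebra+
  \<comment> \<open>A difference without \<open>a\<close>-part would make \<open>e\<close> and
    \<open>f\<close> vanish, and \<open>A1\<close> would then kill \<open>(c,d)\<close>. The nonzero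
    entry found here carries the factor \<open>k\<close> over to the \<open>b\<close>-part.\<close>
  have nd: "\<not> (p dvd e - e' \<and> p dvd f - f')"
  proof
    assume ef: "p dvd e - e' \<and> p dvd f - f'"
    then have ef': "p dvd e" "p dvd f" using k by algebra+
    have s: "p dvd a + b" using ef D by algebra
    have ah: "p dvd a * g" "p dvd a * h" using A1 ef' s by algebra+
    show False
    proof (cases "p dvd a")
      case True
      then have "p dvd b" using s by algebra
      then have "p dvd c" "p dvd d" using A1 ef' by algebra+
      then show False using False by blast
    next
      case a: False
      then have "p dvd g" "p dvd h" using pd ah by blast+
      then have "p dvd c" "p dvd d" using A1 ef' by algebra+
      then show False using False by blast
    qed
  qed
  have kg: "p dvd g' - k * c" "p dvd h' - k * d"
    using nd pd[OF k1(1)] pd[OF k1(2)] pd[OF k1(3)] pd[OF k1(4)] by blast+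
  have fk: "p dvd f - (k + 1) * (f - f')" "p dvd g - (k + 1) * c" "p dvd h - (k + 1) * d"
    using D k kg by algebra+
  \<comment> \<open>\<open>X\<close> and \<open>Y\<close> are the exponents of
    \<open>[a2,b1]\<close> and \<open>[a2,b2]\<close> in the commutator of the common image of
    \<open>a1\<close>, \<open>a2\<close> with the difference of the images of \<open>b1\<close>,
    \<open>b2\<close>. The relations for \<open>a1\<close> and \<open>b2\<close> involve its
    \<open>(k+1)\<close>-fold and \<open>k\<close>-fold.\<close>
  define X where "X = b * c - (f - f') * c"
  define Y where "Y = b * d - (f - f') * d"
  have X: "p dvd c - (k + 1) * X" "p dvd k * c - k * X"
    using A1(3) B2(3) fk k kg aa cc unfolding X_def by algebra+
  have Y: "p dvd c + d - (k + 1) * Y" "p dvd k * (c + d) - k * Y"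
    using A1(4) B2(4) fk k kg aa cc unfolding Y_def by algebra+
  have k0: "p dvd k"
  proof (rule ccontr)
    assume nk: "\<not> p dvd k"
    have "p dvd k * (k * X)" "p dvd k * (k * Y)" using X Y by algebra+
    then have "p dvd X" "p dvd Y" using pd nk by blast+
    then have "p dvd c" "p dvd d" using X Y by algebra+
    then show False using False by blast
  qed
  \<comment> \<open>For \<open>k\<close> zero modulo \<open>p\<close>, the same commutator has
    exponents \<open>t * c\<close> and \<open>t * d\<close> at \<open>[a1,b1]\<close> and
    \<open>[a1,b2]\<close>; by \<open>D(3)\<close>, \<open>b - (f - f')\<close> is congruent to
    \<open>- t\<close>, so \<open>t\<close> governs all four exponents.\<close>
  define t where "t = a - (e - e')"
  have t: "p dvd (t + 1) * c" "p dvd t * d" "p dvd t * d + c + d" "p dvd t * c - (a + b)"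
  proof -
    have *: "p dvd e - (e - e')" "p dvd f - (f - f')" "p dvd g - c" "p dvd h - d"
      using k k0 fk by algebra+
    have "p dvd b - (f - f') + t" using D(3) unfolding t_def by algebra
    with * show "p dvd (t + 1) * c" "p dvd t * d" "p dvd t * d + c + d" "p dvd t * c - (a + b)"
      using A1 unfolding t_def by algebra+
  qed
  show ?thesis
  proof (cases "p dvd t + 1")
    case True
    have "p dvd d" "p dvd c" using True t by algebra+
    then show ?thesis using False by blast
  next
    case nt: False
    then have c: "p dvd c" using pd t by blast
    then have "p dvd (t + 1) * d" using t by algebra
    then have "p dvd d" using pd nt by blast
    then show ?thesis using False c by blast
  qed
qed

text \<open>Expresses that the \<open>p\<close>-th power of \<open>a\<^sub>1\<^sup>x\<^sup>1 a\<^sub>2\<^sup>x\<^sup>2 b\<^sub>1\<^sup>y\<^sup>1 b\<^sub>2\<^sup>y\<^sup>2\<close> is the central element with commutator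
  exponents \<open>s\<^sub>i\<^sub>j\<close>, where \<open>m\<close> is the binomial coefficient \<open>p choose 2\<close>.\<close>

definition power_rel :: "int \<Rightarrow> int \<Rightarrow> int \<Rightarrow> int \<Rightarrow> int \<Rightarrow> int \<Rightarrow> int \<Rightarrow> int \<Rightarrow> int \<Rightarrow> int \<Rightarrow> bool" where
  "power_rel p m x1 x2 y1 y2 s11 s12 s21 s22 \<longleftrightarrow>
     p dvd - m * x1 * y1 - s11 + x1 + x2 \<and> p dvd - m * x1 * y2 - s12 \<and>
     p dvd - m * x2 * y1 - s21 + y1 \<and> p dvd - m * x2 * y2 - s22 + y1 + y2"

lemma power_rel_dvdD:
  assumes "power_rel p m x1 x2 y1 y2 s11 s12 s21 s22" and "p dvd m"
  shows "p dvd x1 + x2 - s11" "p dvd s12" "p dvd y1 - s21" "p dvd y1 + y2 - s22"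
proof -
  note rel = assms(1)[unfolded power_rel_def]
  show "p dvd x1 + x2 - s11" using rel[THEN conjunct1] assms(2) by algebra
  show "p dvd s12" using rel[THEN conjunct2, THEN conjunct1] assms(2) by algebra
  show "p dvd y1 - s21" using rel[THEN conjunct2, THEN conjunct2, THEN conjunct1] assms(2) by algebra
  show "p dvd y1 + y2 - s22" using rel[THEN conjunct2, THEN conjunct2, THEN conjunct2] assms(2) by algebra
qed

lemma power_rel_solutions:
  fixes p :: nat and m a b c d a' b' c' d' e f g h e' f' g' h' :: int
  assumes "prime p" and m: "m = int (p choose 2)"
    and A1: "power_rel (int p) m a b c d (a*g - e*c) (a*h - e*d) (b*g - f*c) (b*h - f*d)"
    and A2: "power_rel (int p) m a' b' c' d' (a*g - e*c) (a*h - e*d) (b*g - f*c) (b*h - f*d)"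
    and B1: "power_rel (int p) m e f g h (a'*(g+g') - (e+e')*c') (a'*(h+h') - (e+e')*d')
      (b'*(g+g') - (f+f')*c') (b'*(h+h') - (f+f')*d')"
    and B2: "power_rel (int p) m e' f' g' h' (a'*g' - e'*c') (a'*h' - e'*d') (b'*g' - f'*c') (b'*h' - f'*d')"
    and comm: "int p dvd a*c' - a'*c" "int p dvd a*d' - a'*d" "int p dvd b*c' - b'*c" "int p dvd b*d' - b'*d"
      "int p dvd e*g' - e'*g" "int p dvd e*h' - e'*h" "int p dvd f*g' - f'*g" "int p dvd f*h' - f'*h"
  shows "(int p dvd a-1 \<and> int p dvd b \<and> int p dvd c \<and> int p dvd d \<and>
      int p dvd a' \<and> int p dvd b'-1 \<and> int p dvd c' \<and> int p dvd d' \<and>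
      int p dvd e \<and> int p dvd f \<and> int p dvd g-1 \<and> int p dvd h \<and>
      int p dvd e' \<and> int p dvd f' \<and> int p dvd g' \<and> int p dvd h'-1) \<or>
    (int p dvd a+b \<and> int p dvd c \<and> int p dvd d \<and> int p dvd a'+b' \<and> int p dvd c' \<and> int p dvd d' \<and>
      int p dvd e+f \<and> int p dvd g \<and> int p dvd h \<and> int p dvd e'+f' \<and> int p dvd g' \<and> int p dvd h')"
proof (cases "p = 2")
  case True
  \<comment> \<open>Here the binomial coefficient is 1, so the correction terms survive; the
    parities of the 16 unknowns serve as propositional variables.\<close>
  have "odd m" by (simp add: m True)
  with A1 A2 B1 B2 comm show ?thesis
    unfolding True power_rel_def of_nat_numeral
    by (simp only: even_add even_diff even_mult_iff even_minus odd_one) sat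
next
  case False
  have "odd p" using prime_odd_nat[OF assms(1)] prime_ge_2_nat[OF assms(1)] False by linarith
  then obtain k where "p = 2 * k + 1" by (rule oddE)
  then have "p choose 2 = p * k" by (simp add: choose_two)
  then have "p dvd p choose 2" by simp
  then have pm: "int p dvd m" unfolding m int_dvd_int_iff .
  have "prime (int p)" using assms(1) by simp
  from odd_prime_solutions[OF this power_rel_dvdD[OF A1 pm] power_rel_dvdD[OF A2 pm]
      power_rel_dvdD[OF B1 pm] power_rel_dvdD[OF B2 pm] comm]
  show ?thesis .
qed

text \<open>As \<open>p\<close> is nonzero, the carries can only be \<open>x1\<close>,
  \<open>x2\<close>, \<open>y1\<close>, \<open>y2\<close> themselves.\<close>

lemma coord_cong_power_rel:
  assumes "coord_cong p (Coord (p * x1) (p * x2) (p * y1) (p * y2)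
      (- m * x1 * y1) (- m * x1 * y2) (- m * x2 * y1) (- m * x2 * y2)) (Coord 0 0 0 0 s11 s12 s21 s22)"
    and "p \<noteq> 0"
  shows "power_rel p m x1 x2 y1 y2 s11 s12 s21 s22"
proof -
  from assms(1) obtain k1 k2 l1 l2 where
    "p * x1 = p * k1" "p * x2 = p * k2" "p * y1 = p * l1" "p * y2 = p * l2"
    and dvd: "p dvd - m * x1 * y1 - s11 + k1 + k2" "p dvd - m * x1 * y2 - s12"
      "p dvd - m * x2 * y1 - s21 + l1" "p dvd - m * x2 * y2 - s22 + l1 + l2"
    unfolding coord_cong_def by (simp only: coord.sel add_0_left) blast
  then have "k1 = x1" "k2 = x2" "l1 = y1" "l2 = y2" using assms(2) by simp_all
  with dvd show ?thesis by (simp only: power_rel_def)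
qed

lemma jk_solutions:
  fixes x1 x2 y1 y2 :: "jk_gen \<Rightarrow> int"
  defines "v \<equiv> \<lambda>g. Coord (x1 g) (x2 g) (y1 g) (y2 g) 0 0 0 0"
  assumes "prime p"
    and rel: "\<And>l r. (l, r) \<in> jk_relations p \<Longrightarrow> coord_cong (int p) (coord_eval v l) (coord_eval v r)"
  shows "(\<forall>g. int p dvd x1 g - cx1 (jk_coord g) \<and> int p dvd x2 g - cx2 (jk_coord g) \<and>
      int p dvd y1 g - cy1 (jk_coord g) \<and> int p dvd y2 g - cy2 (jk_coord g)) \<or>
    (\<forall>g. int p dvd x1 g + x2 g \<and> int p dvd y1 g \<and> int p dvd y2 g)"
proof -
  let ?m = "int (p choose 2)"
  have p0: "int p \<noteq> 0" using assms(2) by auto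
  have all: "(\<forall>g. Q g) \<longleftrightarrow> Q A1 \<and> Q A2 \<and> Q B1 \<and> Q B2" for Q
    by (metis jk_gen.exhaust)
  have pow: "power_rel (int p) ?m (x1 g) (x2 g) (y1 g) (y2 g) s11 s12 s21 s22"
    if "(wpow (letter g) p, wcomm u w) \<in> jk_relations p"
      and "coord_comm (coord_eval v u) (coord_eval v w) = Coord 0 0 0 0 s11 s12 s21 s22"
    for g u w s11 s12 s21 s22
    using rel[OF that(1)] that(2) p0
    by (intro coord_cong_power_rel) (simp_all add: v_def sum_list_replicate_Coord)
  have com: "int p dvd x1 g * y1 g' - x1 g' * y1 g \<and> int p dvd x1 g * y2 g' - x1 g' * y2 g \<and>
      int p dvd x2 g * y1 g' - x2 g' * y1 g \<and> int p dvd x2 g * y2 g' - x2 g' * y2 g"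
    if "(wcomm (letter g) (letter g'), []) \<in> jk_relations p" for g g'
    using rel[OF that] p0 by (auto simp: v_def coord_comm_Coord coord_cong_def zero_coord_def)
  have A12: "(wcomm (letter A1) (letter A2), []) \<in> jk_relations p"
    and B12: "(wcomm (letter B1) (letter B2), []) \<in> jk_relations p"
    by (simp_all add: jk_relations_def)
  have A1: "(wpow (letter A1) p, wcomm (letter A1) (letter B1)) \<in> jk_relations p"
    and A2: "(wpow (letter A2) p, wcomm (letter A1) (letter B1)) \<in> jk_relations p"
    and B1: "(wpow (letter B1) p, wcomm (letter A2) (letter B1 @ letter B2)) \<in> jk_relations p"
    and B2: "(wpow (letter B2) p, wcomm (letter A2) (letter B2)) \<in> jk_relations p"
    by (simp_all add: jk_relations_def)
  have c: "coord_comm (coord_eval v (letter g)) (coord_eval v (letter g')) =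
      Coord 0 0 0 0 (x1 g * y1 g' - x1 g' * y1 g) (x1 g * y2 g' - x1 g' * y2 g)
        (x2 g * y1 g' - x2 g' * y1 g) (x2 g * y2 g' - x2 g' * y2 g)" for g g'
    by (simp add: v_def coord_comm_Coord)
  \<comment> \<open>The product of the images of \<open>b1\<close> and \<open>b2\<close> may have
    nonzero commutator exponents, but these drop out of \<open>coord_comm\<close>.\<close>
  have c': "coord_comm (coord_eval v (letter A2)) (coord_eval v (letter B1 @ letter B2)) =
      Coord 0 0 0 0 (x1 A2 * (y1 B1 + y1 B2) - (x1 B1 + x1 B2) * y1 A2)
        (x1 A2 * (y2 B1 + y2 B2) - (x1 B1 + x1 B2) * y2 A2)
        (x2 A2 * (y1 B1 + y1 B2) - (x2 B1 + x2 B2) * y1 A2)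
        (x2 A2 * (y2 B1 + y2 B2) - (x2 B1 + x2 B2) * y2 A2)"
    by (simp add: v_def coord_comm_Coord)
  note power_rel_solutions[OF assms(2) HOL.refl pow[OF A1 c] pow[OF A2 c] pow[OF B1 c'] pow[OF B2 c]]
  from this com[OF A12] com[OF B12] show ?thesis unfolding all by simp
qed

section \<open>Extendability and the dichotomy for the images\<close>

theorem theorem3:
  fixes p :: nat
    and f :: "jk_gen word set \<Rightarrow> jk_gen word set"
  assumes "prime p"
    and "f \<in> jk_gens p \<rightarrow> jk_reps p"
  shows "(\<exists>\<phi>. normalized_endomorphism p \<phi> \<and> (\<forall>x\<in>jk_gens p. \<phi> x = f x)) \<longleftrightarrow>
         ((\<forall>x\<in>jk_gens p. f x = x) \<or>
          f ` jk_gens p \<subseteq>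
            generate (jk_group p) {jk_elem p A1 \<otimes>\<^bsub>jk_group p\<^esub> inv\<^bsub>jk_group p\<^esub> jk_elem p A2}
              <#>\<^bsub>jk_group p\<^esub> center (jk_group p))"
    (is "?ext \<longleftrightarrow> ?dich")
proof -
  let ?R = "jk_relations p"
  have p1: "1 < p" using assms(1) prime_gt_1_nat by blast
  let ?P = "\<lambda>g k1 k2 l1 l2. f (jk_elem p g) = word_class ?R (rep_word k1 k2 l1 l2) \<and>
      k1 < p \<and> k2 < p \<and> l1 < p \<and> l2 < p"
  have "\<forall>g. \<exists>k1 k2 l1 l2. ?P g k1 k2 l1 l2"
    using assms(2) unfolding jk_gens_eq jk_reps_eq by blast
  from choice[OF this] obtain k1 where "\<forall>g. \<exists>k2 l1 l2. ?P g (k1 g) k2 l1 l2" ..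
  from choice[OF this] obtain k2 where "\<forall>g. \<exists>l1 l2. ?P g (k1 g) (k2 g) l1 l2" ..
  from choice[OF this] obtain l1 where "\<forall>g. \<exists>l2. ?P g (k1 g) (k2 g) (l1 g) l2" ..
  from choice[OF this] obtain l2 where "\<forall>g. ?P g (k1 g) (k2 g) (l1 g) (l2 g)" ..
  then have f: "f (jk_elem p g) = word_class ?R (rep_word (k1 g) (k2 g) (l1 g) (l2 g))"
    and less: "k1 g < p" "k2 g < p" "l1 g < p" "l2 g < p" for g
    by simp_all
  define \<sigma> where "\<sigma> g = rep_word (k1 g) (k2 g) (l1 g) (l2 g)" for g
  have f\<sigma>: "f (word_class ?R (letter g)) = word_class ?R (\<sigma> g)" for g
    using f by (simp add: jk_elem_def \<sigma>_def)
  \<comment> \<open>Exponents of representatives lie below \<open>p\<close>, so congruences become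
    equalities.\<close>
  have multiple_less: "n = 0" if "int p dvd int n" "n < p" for n
    using that by auto
  have cong_less: "int n = c" if "int p dvd int n - c" "n < p" "0 \<le> c" "c < int p" for n c
    using that by (simp flip: mod_eq_dvd_iff)
  \<comment> \<open>Normalization is automatic: the values on the generators are those of
    \<open>f\<close>, which lie in \<open>jk_reps\<close>.\<close>
  have hom_ext: ?ext if "\<phi> \<in> hom (jk_group p) (jk_group p)" "\<And>g. \<phi> (jk_elem p g) = f (jk_elem p g)" for \<phi>
  proof -
    have eq: "\<phi> x = f x" if "x \<in> jk_gens p" for x
      using that \<open>\<And>g. \<phi> (jk_elem p g) = f (jk_elem p g)\<close> unfolding jk_gens_eq by blast
    then have "\<phi> x \<in> jk_reps p" if "x \<in> jk_gens p" for x
      using funcset_mem[OF assms(2) that] that by simp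
    then have "normalized_endomorphism p \<phi>"
      using that(1) unfolding normalized_endomorphism_def by blast
    then show ?ext using eq by blast
  qed
  show ?thesis
  proof
    assume ?ext
    then obtain \<phi> where "normalized_endomorphism p \<phi>" and eq: "\<forall>x\<in>jk_gens p. \<phi> x = f x"
      by (elim exE conjE)
    then have hom: "\<phi> \<in> hom (presented_group ?R) (presented_group ?R)"
      unfolding normalized_endomorphism_def jk_group_def by (elim conjE)
    have "\<phi> (jk_elem p g) = f (jk_elem p g)" for g
      using eq by (simp add: jk_gens_eq)
    then have \<phi>: "\<phi> (word_class ?R w) = word_class ?R (word_subst \<sigma> w)" for w
      using hom_word_class[OF hom, of \<sigma>] by (simp add: f\<sigma> jk_elem_def)
    \<comment> \<open>An endomorphism preserves every relation; evaluating the image relation in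
      exponents gives the hypothesis of \<open>jk_solutions\<close>.\<close>
    have rel: "coord_cong (int p) (coord_eval (\<lambda>g. Coord (int (k1 g)) (int (k2 g)) (int (l1 g)) (int (l2 g)) 0 0 0 0) l)
       (coord_eval (\<lambda>g. Coord (int (k1 g)) (int (k2 g)) (int (l1 g)) (int (l2 g)) 0 0 0 0) r)"
      if "(l, r) \<in> ?R" for l r
    proof -
      have "pres_eq ?R l r" using pres_eq.rel[OF that, of "[]" "[]"] by simp
      then have "\<phi> (word_class ?R l) = \<phi> (word_class ?R r)"
        by (simp only: word_class_eq_iff[symmetric])
      then have "pres_eq ?R (word_subst \<sigma> l) (word_subst \<sigma> r)"
        unfolding \<phi> word_class_eq_iff .
      from jk_pres_eq_coord_cong[OF this] show ?thesis
        by (simp only: coord_eval_subst \<sigma>_def coord_eval_rep_word)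
    qed
    from jk_solutions[OF assms(1) rel] show ?dich
    proof
      assume *: "\<forall>g. int p dvd int (k1 g) - cx1 (jk_coord g) \<and> int p dvd int (k2 g) - cx2 (jk_coord g) \<and>
        int p dvd int (l1 g) - cy1 (jk_coord g) \<and> int p dvd int (l2 g) - cy2 (jk_coord g)"
      have "\<sigma> g = letter g" for g
      proof -
        have "0 \<le> x (jk_coord g) \<and> x (jk_coord g) < int p" if "x \<in> {cx1, cx2, cy1, cy2}" for x
          using that p1 by (cases g) auto
        then have "int (k1 g) = cx1 (jk_coord g)" "int (k2 g) = cx2 (jk_coord g)"
          "int (l1 g) = cy1 (jk_coord g)" "int (l2 g) = cy2 (jk_coord g)"
          using *[rule_format, of g] less[of g] by (intro cong_less; blast)+
        then show ?thesis by (cases g) (simp_all add: \<sigma>_def rep_word_def wpow_def)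
      qed
      then have "\<forall>x\<in>jk_gens p. f x = x" by (auto simp: jk_gens_eq jk_elem_def f\<sigma>)
      then show ?dich ..
    next
      assume *: "\<forall>g. int p dvd int (k1 g) + int (k2 g) \<and> int p dvd int (l1 g) \<and> int p dvd int (l2 g)"
      have "f (jk_elem p g) \<in> cyclic_mod_center p" for g
      proof -
        have "l1 g = 0" "l2 g = 0" using *[rule_format, of g] less[of g] multiple_less by simp_all
        moreover have "p dvd k1 g + k2 g"
          using *[rule_format, of g] by (simp only: of_nat_add[symmetric] int_dvd_int_iff)
        ultimately show ?thesis
          using A1_A2_word_in_cyclic_mod_center by (simp add: f rep_word_def wpow_def)
      qed
      then have "f ` jk_gens p \<subseteq> cyclic_mod_center p"
        unfolding jk_gens_eq by (auto simp only:)
      then show ?dich unfolding cyclic_mod_center_def ..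
    qed
  next
    assume ?dich
    then show ?ext
    proof
      assume "\<forall>x\<in>jk_gens p. f x = x"
      then show ?ext by (intro hom_ext[of "\<lambda>x. x"]) (auto simp: hom_def jk_gens_eq)
    next
      assume "f ` jk_gens p \<subseteq> generate (jk_group p) {jk_elem p A1 \<otimes>\<^bsub>jk_group p\<^esub> inv\<^bsub>jk_group p\<^esub> jk_elem p A2}
              <#>\<^bsub>jk_group p\<^esub> center (jk_group p)"
      then have cyc: "word_class ?R (\<sigma> g) \<in> cyclic_mod_center p" for g
        unfolding cyclic_mod_center_def[symmetric] jk_gens_eq f[symmetric] \<sigma>_def by blast
      have l0: "l1 g = 0" "l2 g = 0" and dvd: "p dvd k1 g + k2 g" for g
      proof -
        note * = cyclic_mod_center_coords[OF cyc[of g, unfolded \<sigma>_def]]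
        show "l1 g = 0" "l2 g = 0" using * p1 less[of g] multiple_less by simp_all
        have "int p dvd int (k1 g + k2 g)" using * p1 by simp
        then show "p dvd k1 g + k2 g" by (simp only: int_dvd_int_iff)
      qed
      have \<sigma>: "\<sigma> g = wpow (letter A1) (k1 g) @ wpow (letter A2) (k2 g)" for g
        by (simp add: \<sigma>_def rep_word_def l0 wpow_def)
      have com: "pres_eq ?R (\<sigma> g @ \<sigma> g') (\<sigma> g' @ \<sigma> g)" for g g'
      proof -
        have A: "pres_eq ?R (letter A1 @ \<sigma> g) (\<sigma> g @ letter A1)" "pres_eq ?R (letter A2 @ \<sigma> g) (\<sigma> g @ letter A2)" for g
          unfolding \<sigma> by (intro commute_append commute_wpow A1_A2_relations pres_eq.sym[OF A1_A2_relations(3)] pres_eq.refl)+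
        show ?thesis unfolding \<sigma>[of g'] by (intro commute_append commute_wpow pres_eq.sym[OF A(1)] pres_eq.sym[OF A(2)])
      qed
      have wcomm: "pres_eq ?R (wcomm (\<sigma> g) (\<sigma> g')) []" for g g'
        unfolding wcomm_eq_Nil_iff by (rule com)
      have wcomm': "pres_eq ?R (wcomm (\<sigma> g) (\<sigma> g' @ \<sigma> g'')) []" for g g' g''
        unfolding wcomm_eq_Nil_iff by (rule pres_eq.sym[OF commute_append[OF com com]])
      have pow: "pres_eq ?R (wpow (\<sigma> g) p) []" for g
        unfolding \<sigma> by (rule A1_A2_word_pow[OF dvd])
      have cl: "pres_eq ?R (wcomm (wcomm u v) w) []" for u v w
        unfolding wcomm_eq_Nil_iff by (rule wcomm_central)
      \<comment> \<open>Both sides of every relation become trivial, since the images commute and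
        have trivial \<open>p\<close>-th powers.\<close>
      have rels: "pres_eq ?R (word_subst \<sigma> l) (word_subst \<sigma> r)" if "(l, r) \<in> ?R" for l r
        using that[unfolded jk_relations_def]
        by (auto intro: cl wcomm pres_eq.trans[OF pow pres_eq.sym[OF wcomm]]
            pres_eq.trans[OF pow pres_eq.sym[OF wcomm']])
      have "\<exists>\<phi> \<in> hom (presented_group ?R) (presented_group ?R).
          \<forall>w. \<phi> (word_class ?R w) = word_class ?R (word_subst \<sigma> w)"
        by (rule subst_hom, rule rels)
      then obtain \<phi> where "\<phi> \<in> hom (presented_group ?R) (presented_group ?R)"
        "\<forall>w. \<phi> (word_class ?R w) = word_class ?R (word_subst \<sigma> w)" by (elim bexE)
      then show ?ext by (intro hom_ext[of \<phi>]) (simp_all add: jk_group_def jk_elem_def f\<sigma>)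
    qed
  qed
qed

end
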